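(* The weakening rules \[ \frac{\Gamma\Rightarrow\Delta}{A,\Gamma\Rightarrow\Delta} \qquad\qquad \frac{\Gamma\Rightarrow\Delta}{\Gamma\Rightarrow\Delta,A} \] are height-preserving admissible in $\mathsf{G3T}^{i}$.
   Context: Formulae are generated from a countable set of propositional variables by $A ::= p \mid \bot \mid A\land A \mid A\lor A \mid A\to A$. The calculus $\mathsf{G3T}^{i}$. Sequents $\Gamma\Rightarrow\Delta$ have $\Gamma,\Delta$ finite multisets of formulae. Initial sequents: $p,\Gamma\Rightarrow\Delta,p$ ($p$ a variable) and $\bot,\Gamma\Rightarrow\Delta$. Rules (premisses / conclusion): - $\land\mathrm L$: $A,B,\Gamma\Rightarrow\Delta$ / $A\land B,\Gamma\Rightarrow\Delta$. - $\lor\mathrm L$: $A,\Gamma\Rightarrow\Delta$ and $B,\Gamma\Rightarrow\Delta$ / $A\lor B,\Gamma\Rightarrow\Delta$. - $\to\!\mathrm L$: $A\to B,\Gamma\Rightarrow\Delta,A$ and $B,\Gamma\Rightarrow\Delta$ / $A\to B,\Gamma\Rightarrow\Delta$. - $\land\mathrm R$: $\Gamma\Rightarrow\Delta,A$ and $\Gamma\Rightarrow\Delta,B$ / $\Gamma\Rightarrow\Delta,A\land B$. - $\lor\mathrm R$: $\Gamma\Rightarrow\Delta,A,B$ / $\Gamma\Rightarrow\Delta,A\lor B$. - $\to\!\mathrm R$: $A,\Gamma\Rightarrow B$ / $\Gamma\Rightarrow\Delta,A\to B$. The height of a derivation is the length of its longest branch (an initial sequent has height $0$). A rule is height-preserving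 admissible if, whenever its premiss has a derivation of height at most $n$, its conclusion has a derivation of height at most $n$. *)

theory Defs
  imports "HOL-Library.Multiset" "HOL-Library.Countable"
begin

datatype 'v form =
    Var 'v
  | Bot  (\<open>\<^bold>\<bottom>\<close>)
  | And "'v form" "'v form"  (infixr \<open>\<^bold>\<and>\<close> 75)
  | Or "'v form" "'v form"  (infixr \<open>\<^bold>\<or>\<close> 74)
  | Imp "'v form" "'v form"  (infixr \<open>\<^bold>\<rightarrow>\<close> 73)

datatype 'v sequent = Sequent "'v form multiset" "'v form multiset"  (infix \<open>\<Rrightarrow>\<close> 55)

text \<open>\<open>G3Ti Ss S\<close>: the sequent \<open>S\<close> follows from the list of premisses \<open>Ss\<close> by one rule
  of the calculus; initial sequents are the rules with no premisses.\<close>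

inductive G3Ti :: "'v sequent list \<Rightarrow> 'v sequent \<Rightarrow> bool" where
  Ax: "G3Ti [] (add_mset (Var p) \<Gamma> \<Rrightarrow> add_mset (Var p) \<Delta>)"
| BotL: "G3Ti [] (add_mset \<^bold>\<bottom> \<Gamma> \<Rrightarrow> \<Delta>)"
| AndL: "G3Ti [add_mset A (add_mset B \<Gamma>) \<Rrightarrow> \<Delta>] (add_mset (A \<^bold>\<and> B) \<Gamma> \<Rrightarrow> \<Delta>)"
| OrL: "G3Ti [add_mset A \<Gamma> \<Rrightarrow> \<Delta>, add_mset B \<Gamma> \<Rrightarrow> \<Delta>] (add_mset (A \<^bold>\<or> B) \<Gamma> \<Rrightarrow> \<Delta>)"
| ImpL: "G3Ti [add_mset (A \<^bold>\<rightarrow> B) \<Gamma> \<Rrightarrow> add_mset A \<Delta>, add_mset B \<Gamma> \<Rrightarrow> \<Delta>]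
           (add_mset (A \<^bold>\<rightarrow> B) \<Gamma> \<Rrightarrow> \<Delta>)"
| AndR: "G3Ti [\<Gamma> \<Rrightarrow> add_mset A \<Delta>, \<Gamma> \<Rrightarrow> add_mset B \<Delta>] (\<Gamma> \<Rrightarrow> add_mset (A \<^bold>\<and> B) \<Delta>)"
| OrR: "G3Ti [\<Gamma> \<Rrightarrow> add_mset A (add_mset B \<Delta>)] (\<Gamma> \<Rrightarrow> add_mset (A \<^bold>\<or> B) \<Delta>)"
| ImpR: "G3Ti [add_mset A \<Gamma> \<Rrightarrow> {#B#}] (\<Gamma> \<Rrightarrow> add_mset (A \<^bold>\<rightarrow> B) \<Delta>)"

datatype 'v tree = Node (root: "'v sequent") (subtrees: "'v tree list")

inductive derivation :: "'v tree \<Rightarrow> bool" where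
  "G3Ti (map root ts) S \<Longrightarrow> (\<And>t. t \<in> set ts \<Longrightarrow> derivation t) \<Longrightarrow> derivation (Node S ts)"

primrec height :: "'v tree \<Rightarrow> nat" where
  "height (Node S ts) = (if ts = [] then 0 else Suc (Max (set (map height ts))))"

definition derivable_within :: "nat \<Rightarrow> 'v sequent \<Rightarrow> bool" where
  "derivable_within n S \<longleftrightarrow> (\<exists>t. derivation t \<and> root t = S \<and> height t \<le> n)"

text \<open>A one-premiss rule is the relation between the premiss and the conclusion of its instances.\<close>

definition hp_admissible :: "('v sequent \<Rightarrow> 'v sequent \<Rightarrow> bool) \<Rightarrow> bool" where
  "hp_admissible R \<longleftrightarrow>
    (\<forall>n S S'. R S S' \<longrightarrow> derivable_within n S \<longrightarrow> derivable_within n S')"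

inductive weakening_L :: "'v sequent \<Rightarrow> 'v sequent \<Rightarrow> bool" where
  "weakening_L (\<Gamma> \<Rrightarrow> \<Delta>) (add_mset A \<Gamma> \<Rrightarrow> \<Delta>)"

inductive weakening_R :: "'v sequent \<Rightarrow> 'v sequent \<Rightarrow> bool" where
  "weakening_R (\<Gamma> \<Rrightarrow> \<Delta>) (\<Gamma> \<Rrightarrow> add_mset A \<Delta>)"

end

theory Submission
  imports Defs
begin

text \<open>
  In every rule the contexts are arbitrary multisets. Adding formulae to the context of the
  conclusion, and the same formulae to the contexts of the premisses, therefore turns an instance of
  a rule into another instance of it (\<open>G3Ti_extend\<close>). The one exception is the rule for
  implication on the right: its premiss has a single succedent formula, so additions to the
  succedent are not passed on to it, but they are absorbed by the context \<open>\<Delta>\<close> that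
  appears only in its conclusion. In all cases each new premiss extends an old one, so a derivation
  of a sequent can be rewritten from its root upwards into a derivation of any larger sequent
  (\<open>derivation_extend\<close>). The rewriting keeps the shape of the tree, and hence its height.

  The induction allows any number of additions on either side, including none. This makes it
  symmetric in the two weakening rules, and it also covers uniformly the premiss of the rule for
  implication on the right, which receives nothing when only the succedent grows.
\<close>

fun extends :: "'v sequent \<Rightarrow> 'v sequent \<Rightarrow> bool" where
  "extends (\<Gamma> \<Rrightarrow> \<Delta>) (\<Gamma>' \<Rrightarrow> \<Delta>') \<longleftrightarrow> \<Gamma> \<subseteq># \<Gamma>' \<and> \<Delta> \<subseteq># \<Delta>'"

text \<open>The new formulae join the context of the rule, and are copied into the premisses that share
  that context.\<close>

lemma G3Ti_extend:
  assumes "G3Ti Ss S" and "extends S S'"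
  obtains Ss' where "G3Ti Ss' S'" and "list_all2 extends Ss Ss'"
proof -
  obtain \<Gamma>\<^sub>0 \<Delta>\<^sub>0 \<Theta> \<Lambda> where S: "S = (\<Gamma>\<^sub>0 \<Rrightarrow> \<Delta>\<^sub>0)" and S': "S' = (\<Gamma>\<^sub>0 + \<Theta> \<Rrightarrow> \<Delta>\<^sub>0 + \<Lambda>)"
    using assms(2) by (cases S; cases S') (auto simp: mset_subset_eq_exists_conv)
  have "\<exists>Ss'. G3Ti Ss' (\<Gamma>\<^sub>0 + \<Theta> \<Rrightarrow> \<Delta>\<^sub>0 + \<Lambda>) \<and> list_all2 extends Ss Ss'"
    using assms(1) unfolding S
  proof cases
    \<comment> \<open>In each case the first call of the simplifier fixes the witness \<open>Ss'\<close> as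
      the premisses of the enlarged rule instance.\<close>
    case (Ax p \<Gamma> \<Delta>)
    then show ?thesis
      using G3Ti.Ax[of p "\<Gamma> + \<Theta>" "\<Delta> + \<Lambda>"]
      by (intro exI conjI, simp, simp)
  next
    case (BotL \<Gamma>)
    then show ?thesis
      using G3Ti.BotL[of "\<Gamma> + \<Theta>" "\<Delta>\<^sub>0 + \<Lambda>"]
      by (intro exI conjI, simp, simp)
  next
    case (AndL A B \<Gamma>)
    then show ?thesis
      using G3Ti.AndL[of A B "\<Gamma> + \<Theta>" "\<Delta>\<^sub>0 + \<Lambda>"]
      by (intro exI conjI, simp, simp)
  next
    case (OrL A \<Gamma> B)
    then show ?thesis
      using G3Ti.OrL[of A "\<Gamma> + \<Theta>" "\<Delta>\<^sub>0 + \<Lambda>" B]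
      by (intro exI conjI, simp, simp)
  next
    case (ImpL A B \<Gamma>)
    then show ?thesis
      using G3Ti.ImpL[of A B "\<Gamma> + \<Theta>" "\<Delta>\<^sub>0 + \<Lambda>"]
      by (intro exI conjI, simp, simp)
  next
    case (AndR A \<Delta> B)
    then show ?thesis
      using G3Ti.AndR[of "\<Gamma>\<^sub>0 + \<Theta>" A "\<Delta> + \<Lambda>" B]
      by (intro exI conjI, simp, simp)
  next
    case (OrR A B \<Delta>)
    then show ?thesis
      using G3Ti.OrR[of "\<Gamma>\<^sub>0 + \<Theta>" A B "\<Delta> + \<Lambda>"]
      by (intro exI conjI, simp, simp)
  next
    case (ImpR A B \<Delta>)
    \<comment> \<open>The premiss gains \<open>\<Theta>\<close> only; \<open>\<Lambda>\<close> enters with the conclusion.\<close>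
    then show ?thesis
      using G3Ti.ImpR[of A "\<Gamma>\<^sub>0 + \<Theta>" B "\<Delta> + \<Lambda>"]
      by (intro exI conjI, simp, simp)
  qed
  then show thesis
    using that S' by blast
qed

lemma height_Node_mono:
  assumes "list_all2 (\<lambda>t t'. height t' \<le> height t) ts ts'"
  shows "height (Node S' ts') \<le> height (Node S ts)"
proof (cases "ts = []")
  case True
  with assms show ?thesis by simp
next
  case False
  with assms have "ts' \<noteq> []" by auto
  have "height t' \<le> Max (height ` set ts)" if "t' \<in> set ts'" for t'
  proof -
    from assms that obtain t where "t \<in> set ts" and "height t' \<le> height t"
      by (metis list_all2_conv_all_nth in_set_conv_nth)
    moreover from \<open>t \<in> set ts\<close> have "height t \<le> Max (height ` set ts)" by simp
    ultimately show ?thesis by linarith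
  qed
  with False \<open>ts' \<noteq> []\<close> show ?thesis by simp
qed

lemma derivation_extend:
  assumes "derivation t" and "extends (root t) S'"
  shows "\<exists>t'. derivation t' \<and> root t' = S' \<and> height t' \<le> height t"
  using assms
proof (induction t arbitrary: S' rule: derivation.induct)
  case (1 ts S)
  obtain Ss' where step: "G3Ti Ss' S'" and "list_all2 extends (map root ts) Ss'"
    using G3Ti_extend[of "map root ts" S S'] "1.hyps"(1) "1.prems" by auto
  then have "list_all2 (\<lambda>t. extends (root t)) ts Ss'"
    by (simp add: list_all2_map1)
  \<comment> \<open>The composition of relations expresses that every subtree has a replacement; distributing
    \<open>list_all2\<close> over it chooses all the replacements at once.\<close>
  then have "list_all2 ((\<lambda>t t'. derivation t' \<and> height t' \<le> height t) OO (\<lambda>t' S. root t' = S)) ts Ss'"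
    by (rule list.rel_mono_strong) (use "1.IH" in blast)
  then obtain ts' where ts': "list_all2 (\<lambda>t t'. derivation t' \<and> height t' \<le> height t) ts ts'"
    and "list_all2 (\<lambda>t' S. root t' = S) ts' Ss'"
    by (auto simp: list.rel_compp)
  then have "map root ts' = Ss'"
    by (simp add: list_all2_conv_all_nth list_eq_iff_nth_eq)
  moreover have "derivation t'" if "t' \<in> set ts'" for t'
    using ts' that by (auto simp: list_all2_conv_all_nth in_set_conv_nth)
  ultimately have "derivation (Node S' ts')"
    using step by (auto intro: derivation.intros)
  moreover have "height (Node S' ts') \<le> height (Node S ts)"
    using ts' by (intro height_Node_mono) (rule list.rel_mono_strong, blast+)
  ultimately show ?case
    by (intro exI[of _ "Node S' ts'"]) (simp del: height.simps)
qed

lemma hp_admissible_if_extends: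
  assumes "\<And>S S'. R S S' \<Longrightarrow> extends S S'"
  shows "hp_admissible R"
  unfolding hp_admissible_def derivable_within_def
proof (intro allI impI)
  fix n S S'
  assume "R S S'" and "\<exists>t. derivation t \<and> root t = S \<and> height t \<le> n"
  then obtain t where "derivation t" and "extends (root t) S'" and n: "height t \<le> n"
    using assms by blast
  with derivation_extend obtain t' where "derivation t'" and "root t' = S'"
    and "height t' \<le> height t"
    by blast
  moreover from this n have "height t' \<le> n"
    by simp
  ultimately show "\<exists>t. derivation t \<and> root t = S' \<and> height t \<le> n"
    by blast
qed

theorem lemma4p2:
  shows "hp_admissible (weakening_L :: 'v::countable sequent \<Rightarrow> 'v sequent \<Rightarrow> bool) \<and>
    hp_admissible (weakening_R :: 'v sequent \<Rightarrow> 'v sequent \<Rightarrow> bool)"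
  by (intro conjI hp_admissible_if_extends; erule weakening_L.cases weakening_R.cases) simp_all

end
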